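(* Suppose Assumptions 1, 2 and 3 (stated in the context) hold. Consider a trajectory $(x_i(t),\lambda_i(t),z_i(t))_{i\in\mathcal{N}}$, $t\ge 0$, of the projected algorithm $$\dot{x}_i = P_{\Omega_i}\big(x_i-\nabla f_i(x_i)+\lambda_i\big)-x_i,$$ $$\dot{\lambda}_i = -\sum_{j\in\mathcal{N}_i}(\lambda_i-\lambda_j)-\sum_{j\in\mathcal{N}_i}(z_i-z_j)+(d_i-x_i),$$ $$\dot{z}_i = \sum_{j\in\mathcal{N}_i}(\lambda_i-\lambda_j),\qquad i\in\mathcal{N}.$$ If $x_i(0)\in\Omega_i$ for all $i\in\mathcal{N}$, then $x_i(t)\in\Omega_i$ for all $t\ge 0$ and all $i\in\mathcal{N}$. Moreover, if $(X^*,\Lambda^*,Z^* )$, with $X^*=(x_1^*,\dots,x_n^* )$, $\Lambda^*=(\lambda_1^*,\dots,\lambda_n^* )$, $Z^*=(z_1^*,\dots,z_n^* )$, is an equilibrium point of this algorithm, then $X^*$ is the optimal solution of the distributed resource allocation optimization problem $$\min_{x_1,\dots,x_n\in\mathbf{R}^m}\ \sum_{i\in\mathcal{N}} f_i(x_i)\quad\text{subject to}\quad \sum_{i\in\mathcal{N}}x_i=\sum_{i\in\mathcal{N}}d_i,\quad x_i\in\Omega_i,\ i\in\mathcal{N}.$$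
   Context: Let $\mathcal{N}=\{1,\dots,n\}$ be a set of agents. For each $i\in\mathcal{N}$, $\Omega_i\subset\mathbf{R}^m$ is a closed convex set, $d_i\in\mathbf{R}^m$ is a given vector (local resource), and $f_i:\mathbf{R}^m\to\mathbf{R}$ is a local objective function. The resource allocation problem is to minimize $\sum_{i} f_i(x_i)$ over $x_1,\dots,x_n\in\mathbf{R}^m$ subject to $\sum_i x_i=\sum_i d_i$ and $x_i\in\Omega_i$ for all $i$. $P_{\Omega}(x)=\arg\min_{y\in\Omega}\|x-y\|$ denotes the Euclidean projection onto a closed convex set $\Omega$. $\mathcal{G}=(\mathcal{N},\mathcal{E})$ is the communication graph, and $\mathcal{N}_i=\{j : (j,i)\in\mathcal{E}\}$ is the neighbor set of agent $i$. The state variables are $x_i,\lambda_i,z_i\in\mathbf{R}^m$ for $i\in\mathcal{N}$. A trajectory is a solution of the system of differential equations for $t\ge0$. An equilibrium point is a point at which the right-hand sides of all the differential equations vanish. Assumption 1: the functions $f_i$, $i\in\mathcal{N}$, are continuously differentiable convex functions with locally Lipschitz continuous gradients and with positive definite Hessians over $\mathbf{R}^m$. Assumption 2: there exists a finite optimal solution $X^*$ to the resource allocation problem, and Slater's condition holds: there exist $\tilde{x}_i\in \mathrm{int}(\Omega_i)$, $i\in\mathcal{N}$, with $\sum_{i}\tilde{x}_i=\sum_i d_i$. Assumption 3: the graph $\mathcal{G}$ is undirected and connected. *)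

theory Defs
  imports "HOL-Analysis.Analysis" "Graph_Theory.Pair_Digraph" "Graph_Theory.Digraph_Component"
begin

text \<open>
  The agents are the elements of a finite type \<open>'n\<close> and the local variables live in \<open>real^'m\<close>, so
  that a stacked vector \<open>(x\<^sub>1, \<dots>, x\<^sub>n)\<close> has type \<open>real^'m^'n\<close>.
\<close>

definition gradient :: "('a::real_inner \<Rightarrow> real) \<Rightarrow> 'a \<Rightarrow> 'a" where
  "gradient f x = (THE D. GDERIV f x :> D)"

definition has_hessian :: "(real^'m \<Rightarrow> real) \<Rightarrow> real^'m^'m \<Rightarrow> real^'m \<Rightarrow> bool" where
  "has_hessian f H x \<longleftrightarrow> (gradient f has_derivative (\<lambda>h. H *v h)) (at x)"

text \<open>
  Symmetry is not part of the next definition: it is only applied to Hessians, and the Hessian of a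
  function whose gradient is Frechet differentiable is always symmetric.
\<close>

definition positive_definite :: "real^'m^'m \<Rightarrow> bool" where
  "positive_definite H \<longleftrightarrow> (\<forall>h. h \<noteq> 0 \<longrightarrow> h \<bullet> (H *v h) > 0)"

text \<open>
  The library's \<^const>\<open>local_lipschitz\<close> is about functions with an additional time parameter, which is a
  dummy here.
\<close>

definition admissible_objective :: "(real^'m \<Rightarrow> real) \<Rightarrow> bool" where
  "admissible_objective f \<longleftrightarrow>
     (\<forall>x. f differentiable (at x)) \<and> continuous_on UNIV (gradient f) \<and>
     convex_on UNIV f \<and>
     local_lipschitz (UNIV :: real set) UNIV (\<lambda>_. gradient f) \<and>
     (\<forall>x. \<exists>H. has_hessian f H x \<and> positive_definite H)"

definition feasible :: "('n \<Rightarrow> (real^'m) set) \<Rightarrow> real^'m^'n \<Rightarrow> real^'m^'n \<Rightarrow> bool" where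
  "feasible \<Omega> d X \<longleftrightarrow> (\<Sum>i\<in>UNIV. X $ i) = (\<Sum>i\<in>UNIV. d $ i) \<and> (\<forall>i. X $ i \<in> \<Omega> i)"

definition optimal_solution ::
  "('n \<Rightarrow> (real^'m) set) \<Rightarrow> real^'m^'n \<Rightarrow> ('n \<Rightarrow> real^'m \<Rightarrow> real) \<Rightarrow> real^'m^'n \<Rightarrow> bool" where
  "optimal_solution \<Omega> d f X \<longleftrightarrow> is_arg_min (\<lambda>Y. \<Sum>i\<in>UNIV. f i (Y $ i)) (feasible \<Omega> d) X"

definition slater_condition :: "('n \<Rightarrow> (real^'m) set) \<Rightarrow> real^'m^'n \<Rightarrow> bool" where
  "slater_condition \<Omega> d \<longleftrightarrow>
     (\<exists>X. (\<forall>i. X $ i \<in> interior (\<Omega> i)) \<and> (\<Sum>i\<in>UNIV. X $ i) = (\<Sum>i\<in>UNIV. d $ i))"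

text \<open>
  An undirected graph is a symmetric digraph. Self-loops are not excluded; they do not contribute to
  the dynamics below.
\<close>

definition undirected_connected_graph :: "'n pair_pre_digraph \<Rightarrow> bool" where
  "undirected_connected_graph G \<longleftrightarrow>
     pair_pseudo_graph G \<and> pverts G = UNIV \<and> Digraph_Component.connected (with_proj G)"

definition neighbors :: "'n pair_pre_digraph \<Rightarrow> 'n \<Rightarrow> 'n set" where
  "neighbors G i = {j. (j, i) \<in> parcs G}"

definition rhs_x ::
  "('n \<Rightarrow> (real^'m) set) \<Rightarrow> ('n \<Rightarrow> real^'m \<Rightarrow> real) \<Rightarrow> real^'m^'n \<Rightarrow> real^'m^'n \<Rightarrow> real^'m^'n" where
  "rhs_x \<Omega> f x l = (\<chi> i. closest_point (\<Omega> i) (x $ i - gradient (f i) (x $ i) + l $ i) - x $ i)"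

definition rhs_lambda ::
  "'n pair_pre_digraph \<Rightarrow> real^'m^'n \<Rightarrow> real^'m^'n \<Rightarrow> real^'m^'n \<Rightarrow> real^'m^'n \<Rightarrow> real^'m^'n" where
  "rhs_lambda G d x l z =
     (\<chi> i. - (\<Sum>j\<in>neighbors G i. l $ i - l $ j) - (\<Sum>j\<in>neighbors G i. z $ i - z $ j) + (d $ i - x $ i))"

definition rhs_z :: "'n pair_pre_digraph \<Rightarrow> real^'m^'n \<Rightarrow> real^'m^'n" where
  "rhs_z G l = (\<chi> i. \<Sum>j\<in>neighbors G i. l $ i - l $ j)"

definition trajectory ::
  "'n::finite pair_pre_digraph \<Rightarrow> ('n \<Rightarrow> (real^'m) set) \<Rightarrow> real^'m^'n \<Rightarrow> ('n \<Rightarrow> real^'m \<Rightarrow> real) \<Rightarrow>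
   (real \<Rightarrow> real^'m^'n) \<Rightarrow> (real \<Rightarrow> real^'m^'n) \<Rightarrow> (real \<Rightarrow> real^'m^'n) \<Rightarrow> bool" where
  "trajectory G \<Omega> d f x l z \<longleftrightarrow> (\<forall>t\<ge>0.
     (x has_vector_derivative rhs_x \<Omega> f (x t) (l t)) (at t within {0..}) \<and>
     (l has_vector_derivative rhs_lambda G d (x t) (l t) (z t)) (at t within {0..}) \<and>
     (z has_vector_derivative rhs_z G (l t)) (at t within {0..}))"

definition equilibrium ::
  "'n pair_pre_digraph \<Rightarrow> ('n \<Rightarrow> (real^'m) set) \<Rightarrow> real^'m^'n \<Rightarrow> ('n \<Rightarrow> real^'m \<Rightarrow> real) \<Rightarrow>
   real^'m^'n \<Rightarrow> real^'m^'n \<Rightarrow> real^'m^'n \<Rightarrow> bool" where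
  "equilibrium G \<Omega> d f X L Z \<longleftrightarrow> rhs_x \<Omega> f X L = 0 \<and> rhs_lambda G d X L Z = 0 \<and> rhs_z G L = 0"

end

theory Submission
  imports Defs
begin

text \<open>
  \<^emph>\<open>Invariance.\<close> Each \<open>x\<^sub>i\<close> is driven towards a point of \<open>\<Omega>\<^sub>i\<close>, since its velocity is \<open>p - x\<^sub>i\<close> with
  \<open>p\<close> a projection onto \<open>\<Omega>\<^sub>i\<close>. For a half-space \<open>{y. a \<bullet> y \<ge> b}\<close> containing \<open>\<Omega>\<^sub>i\<close>, the quantity
  \<open>exp t * (a \<bullet> x\<^sub>i t - b)\<close> therefore has the nonnegative derivative \<open>exp t * (a \<bullet> p - b)\<close>, so the
  trajectory never leaves that half-space; and a closed convex set is the intersection of the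
  half-spaces containing it (\<open>relaxation_towards_convex_set_invariant\<close>).

  \<^emph>\<open>Optimality.\<close> An equilibrium is a Karush-Kuhn-Tucker point. The third equation says that the graph
  Laplacian annihilates \<open>\<Lambda>\<close>, so on a connected graph all multipliers \<open>\<lambda>\<^sub>i\<close> equal one vector \<open>c\<close>
  (\<open>laplacian_kernel_constant\<close>). Laplacian images sum to zero, so summing the second equation over the
  agents gives the resource constraint. The first equation says that \<open>x\<^sub>i\<close> is the projection of
  \<open>x\<^sub>i - \<nabla>f\<^sub>i(x\<^sub>i) + c\<close>, which is the variational inequality
  \<open>\<nabla>f\<^sub>i(x\<^sub>i) \<bullet> (y - x\<^sub>i) \<ge> c \<bullet> (y - x\<^sub>i)\<close> on \<open>\<Omega>\<^sub>i\<close>.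
  Positive definite Hessians make every \<open>f\<^sub>i\<close> lie strictly above its tangents
  (\<open>strict_gradient_inequality\<close>). Hence for any feasible \<open>Y\<close> the total cost exceeds that of \<open>X\<close> by at
  least \<open>c \<bullet> (\<Sum>i. Y\<^sub>i - X\<^sub>i) = 0\<close>, strictly unless \<open>Y = X\<close>
  (\<open>common_multiplier_imp_strict_minimum\<close>), which yields both optimality and uniqueness.
\<close>

section \<open>Invariance of closed convex sets\<close>

text \<open>
  If \<open>x t\<close> were outside \<open>S\<close>, a hyperplane would separate it from \<open>S\<close>. The factor \<open>exp s\<close> in the proof
  is the integrating factor that removes the \<open>- x\<close> term, so that the signed distance to that
  hyperplane, weighted by \<open>exp s\<close>, is nondecreasing and cannot change from positive to negative.
\<close>

lemma relaxation_towards_convex_set_invariant: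
  fixes x p :: "real \<Rightarrow> 'a::euclidean_space"
  assumes S: "closed S" "convex S"
    and deriv: "\<And>t. 0 \<le> t \<Longrightarrow> (x has_vector_derivative p t - x t) (at t within {0..})"
    and p: "\<And>t. 0 \<le> t \<Longrightarrow> p t \<in> S"
    and x0: "x 0 \<in> S" and t: "0 \<le> t"
  shows "x t \<in> S"
proof (rule ccontr)
  assume "x t \<notin> S"
  then obtain a b where ab: "a \<bullet> x t < b" "\<And>y. y \<in> S \<Longrightarrow> b < a \<bullet> y"
    using separating_hyperplane_closed_point[OF S(2,1)] by blast
  define g where "g s = exp s * (a \<bullet> x s - b)" for s
  have g_deriv: "(g has_real_derivative exp s * (a \<bullet> p s - b)) (at s within {0..})" if "0 \<le> s" for s
  proof -
    have "((\<lambda>s. a \<bullet> x s) has_vector_derivative a \<bullet> (p s - x s)) (at s within {0..})"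
      by (rule bounded_linear.has_vector_derivative[OF bounded_linear_inner_right deriv[OF that]])
    then have "((\<lambda>s. a \<bullet> x s) has_real_derivative a \<bullet> (p s - x s)) (at s within {0..})"
      by (simp add: has_real_derivative_iff_has_vector_derivative)
    then show ?thesis
      unfolding g_def
      by (auto intro!: derivative_eq_intros simp: algebra_simps inner_diff_right)
  qed
  have "g 0 \<le> g t"
  proof (rule DERIV_nonneg_imp_increasing_open[OF t])
    fix s :: real assume s: "0 < s" "s < t"
    have "(g has_real_derivative exp s * (a \<bullet> p s - b)) (at s)"
      using g_deriv[of s] s at_within_interior[of s "{0..}"] by simp
    moreover have "0 \<le> exp s * (a \<bullet> p s - b)"
      using ab(2)[OF p[of s]] s by simp
    ultimately show "\<exists>y. (g has_real_derivative y) (at s) \<and> 0 \<le> y" by blast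
  next
    have "continuous_on {0..} g"
      using g_deriv by (intro DERIV_continuous_on) auto
    then show "continuous_on {0..t} g" by (rule continuous_on_subset) auto
  qed
  moreover have "0 < g 0" using ab(2)[OF x0] by (simp add: g_def)
  moreover have "g t < 0" using ab(1) by (simp add: g_def mult_pos_neg)
  ultimately show False by simp
qed

section \<open>Graph Laplacians\<close>

lemma sum_symmetric_neighborhoods_swap:
  fixes N :: "'n::finite \<Rightarrow> 'n set" and F :: "'n \<Rightarrow> 'n \<Rightarrow> 'a::comm_monoid_add"
  assumes "\<And>i j. j \<in> N i \<longleftrightarrow> i \<in> N j"
  shows "(\<Sum>i\<in>UNIV. \<Sum>j\<in>N i. F i j) = (\<Sum>i\<in>UNIV. \<Sum>j\<in>N i. F j i)"
proof -
  have preimage: "{i. j \<in> N i} = N j" for j using assms by auto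
  have "(\<Sum>i\<in>UNIV. \<Sum>j\<in>N i. F i j) = (\<Sum>i\<in>UNIV. \<Sum>j | j \<in> UNIV \<and> j \<in> N i. F i j)"
    by simp
  also have "\<dots> = (\<Sum>j\<in>UNIV. \<Sum>i | i \<in> UNIV \<and> j \<in> N i. F i j)"
    by (rule sum.swap_restrict) auto
  also have "\<dots> = (\<Sum>j\<in>UNIV. \<Sum>i\<in>N j. F i j)"
    by (simp add: preimage)
  finally show ?thesis .
qed

lemma sum_laplacian_eq_0:
  fixes N :: "'n::finite \<Rightarrow> 'n set" and v :: "'n \<Rightarrow> 'a::ab_group_add"
  assumes "\<And>i j. j \<in> N i \<longleftrightarrow> i \<in> N j"
  shows "(\<Sum>i\<in>UNIV. \<Sum>j\<in>N i. v i - v j) = 0"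
proof -
  have "(\<Sum>i\<in>UNIV. \<Sum>j\<in>N i. v i) = (\<Sum>i\<in>UNIV. \<Sum>j\<in>N i. v j)"
    by (rule sum_symmetric_neighborhoods_swap[OF assms])
  then show ?thesis by (simp only: sum_subtractf) simp
qed

text \<open>Summation by parts. Each undirected edge is counted in both directions, hence the factor 2. The
  left side vanishes only if \<open>v\<close> agrees across every edge, which makes the kernel of the Laplacian
  accessible.\<close>

lemma dirichlet_energy:
  fixes N :: "'n::finite \<Rightarrow> 'n set" and v :: "'n \<Rightarrow> 'a::real_inner"
  assumes "\<And>i j. j \<in> N i \<longleftrightarrow> i \<in> N j"
  shows "(\<Sum>i\<in>UNIV. \<Sum>j\<in>N i. (norm (v i - v j))\<^sup>2)
       = 2 * (\<Sum>i\<in>UNIV. v i \<bullet> (\<Sum>j\<in>N i. v i - v j))"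
proof -
  have "(\<Sum>i\<in>UNIV. \<Sum>j\<in>N i. (norm (v i - v j))\<^sup>2)
      = (\<Sum>i\<in>UNIV. \<Sum>j\<in>N i. v i \<bullet> (v i - v j)) + (\<Sum>i\<in>UNIV. \<Sum>j\<in>N i. v j \<bullet> (v j - v i))"
    by (simp add: power2_norm_eq_inner inner_diff_left inner_diff_right inner_commute
        algebra_simps flip: sum.distrib)
  also have "(\<Sum>i\<in>UNIV. \<Sum>j\<in>N i. v j \<bullet> (v j - v i)) = (\<Sum>i\<in>UNIV. \<Sum>j\<in>N i. v i \<bullet> (v i - v j))"
    by (rule sum_symmetric_neighborhoods_swap[OF assms])
  finally show ?thesis by (simp add: inner_sum_right)
qed

lemma neighbors_symmetric:
  assumes "undirected_connected_graph G"
  shows "j \<in> neighbors G i \<longleftrightarrow> i \<in> neighbors G j"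
proof -
  interpret pair_pseudo_graph G using assms by (simp add: undirected_connected_graph_def)
  show ?thesis unfolding neighbors_def using arcs_symmetric by blast
qed

lemma neighborwise_constant_imp_constant:
  assumes G: "undirected_connected_graph G"
    and edge: "\<And>i j. j \<in> neighbors G i \<Longrightarrow> v i = v j"
  shows "v i = v k"
proof -
  interpret pair_pseudo_graph G using G by (simp add: undirected_connected_graph_def)
  have "i \<rightarrow>\<^sup>*\<^bsub>with_proj (mk_symmetric (with_proj G))\<^esub> k"
    using G by (auto simp: undirected_connected_graph_def connected_def strongly_connected_def)
  then have "(i, k) \<in> rtrancl_on UNIV (parcs (mk_symmetric (with_proj G)))"
    using G by (simp add: reachable_def undirected_connected_graph_def)
  then show ?thesis
  proof induction
    case (step j k)
    then have "(j, k) \<in> parcs G \<or> (k, j) \<in> parcs G" by (auto simp: parcs_mk_symmetric)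
    then have "v j = v k" using edge by (auto simp: neighbors_def)
    then show ?case using step by simp
  qed simp
qed

lemma laplacian_kernel_constant:
  fixes v :: "'n::finite \<Rightarrow> 'a::real_inner"
  assumes G: "undirected_connected_graph G"
    and kernel: "\<And>i. (\<Sum>j\<in>neighbors G i. v i - v j) = 0"
  shows "v i = v k"
proof (rule neighborwise_constant_imp_constant[OF G])
  fix i j assume j: "j \<in> neighbors G i"
  have "(\<Sum>i\<in>UNIV. \<Sum>j\<in>neighbors G i. (norm (v i - v j))\<^sup>2) = 0"
    using dirichlet_energy[OF neighbors_symmetric[OF G], of v] kernel by simp
  then have "(\<Sum>j\<in>neighbors G i. (norm (v i - v j))\<^sup>2) = 0"
    by (subst (asm) sum_nonneg_eq_0_iff) (auto intro: sum_nonneg)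
  then have "(norm (v i - v j))\<^sup>2 = 0"
    using j by (subst (asm) sum_nonneg_eq_0_iff) auto
  then show "v i = v j" by simp
qed

section \<open>Gradients and strict convexity\<close>

lemma GDERIV_gradient:
  fixes f :: "'a::euclidean_space \<Rightarrow> real"
  assumes "f differentiable (at x)"
  shows "GDERIV f x :> gradient f x"
  unfolding gradient_def
proof (rule theI')
  obtain f' where f': "(f has_derivative f') (at x)"
    using assms by (auto simp: differentiable_def)
  have "f' = (\<lambda>h. h \<bullet> adjoint f' 1)"
    using adjoint_works[OF has_derivative_linear[OF f'], of _ 1] by auto
  then have "GDERIV f x :> adjoint f' 1" using f' by (simp add: gderiv_def)
  moreover have "D = D'" if "GDERIV f x :> D" "GDERIV f x :> D'" for D D'
    using has_derivative_unique[OF that[unfolded gderiv_def]] by (metis vector_eq_ldot)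
  ultimately show "\<exists>!D. GDERIV f x :> D" by blast
qed

text \<open>Along the segment from \<open>x\<close> to \<open>y\<close> the slope of \<open>f\<close> is strictly increasing, its derivative being
  the Hessian form in the direction \<open>y - x\<close>; the mean value theorem compares the increment of \<open>f\<close>
  with the initial slope.\<close>

lemma strict_gradient_inequality:
  fixes f :: "real^'m \<Rightarrow> real"
  assumes diff: "\<And>x. f differentiable (at x)"
    and hess: "\<And>x. \<exists>H. has_hessian f H x \<and> positive_definite H"
    and "y \<noteq> x"
  shows "f x + gradient f x \<bullet> (y - x) < f y"
proof -
  define h where "h = y - x"
  have h: "h \<noteq> 0" using \<open>y \<noteq> x\<close> by (simp add: h_def)
  define \<phi> where "\<phi> t = f (x + t *\<^sub>R h)" for t
  define \<psi> where "\<psi> t = h \<bullet> gradient f (x + t *\<^sub>R h)" for t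
  have line: "((\<lambda>t. x + t *\<^sub>R h) has_derivative (\<lambda>s. s *\<^sub>R h)) (at t)" for t
    by (auto intro!: derivative_eq_intros)
  have \<phi>: "(\<phi> has_real_derivative \<psi> t) (at t)" for t
  proof -
    have "(f has_derivative (\<lambda>k. k \<bullet> gradient f (x + t *\<^sub>R h))) (at (x + t *\<^sub>R h))"
      using GDERIV_gradient[OF diff] by (simp add: gderiv_def)
    from has_derivative_compose[OF line this] show ?thesis
      unfolding has_field_derivative_def \<phi>_def[abs_def] \<psi>_def
      by (simp add: mult_commute_abs)
  qed
  have \<psi>: "\<exists>D. (\<psi> has_real_derivative D) (at t) \<and> 0 < D" for t
  proof -
    obtain H where H: "has_hessian f H (x + t *\<^sub>R h)" "positive_definite H"
      using hess by blast
    from has_derivative_compose[OF line H(1)[unfolded has_hessian_def]]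
    have "((\<lambda>t. gradient f (x + t *\<^sub>R h)) has_derivative (\<lambda>s. H *v (s *\<^sub>R h))) (at t)" .
    from has_derivative_inner_right[OF this, of h]
    have "(\<psi> has_real_derivative h \<bullet> (H *v h)) (at t)"
      unfolding has_field_derivative_def \<psi>_def[abs_def]
      by (simp add: matrix_vector_mult_scaleR mult_commute_abs)
    then show ?thesis using H(2) h by (auto simp: positive_definite_def)
  qed
  obtain \<xi> :: real where \<xi>: "0 < \<xi>" "\<phi> 1 - \<phi> 0 = \<psi> \<xi>"
    using MVT2[of 0 1 \<phi> \<psi>] \<phi> by auto
  have "\<psi> 0 < \<psi> \<xi>"
    using DERIV_pos_imp_increasing[OF \<xi>(1)] \<psi> by blast
  then show ?thesis using \<xi>(2) by (simp add: \<phi>_def \<psi>_def h_def inner_commute)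
qed

section \<open>Equilibria are optimal\<close>

text \<open>This is sufficiency of the Karush-Kuhn-Tucker conditions for a single multiplier \<open>c\<close> shared by
  all agents: summed over the agents, the variational inequalities bound the first-order change of
  the cost below by \<open>c\<close> paired with the change of the total resource, which is zero.\<close>

lemma common_multiplier_imp_strict_minimum:
  fixes X Y :: "real^'m^'n::finite"
  assumes above: "\<And>i y. y \<noteq> X $ i \<Longrightarrow> f i (X $ i) + g i \<bullet> (y - X $ i) < f i y"
    and vi: "\<And>i. c \<bullet> (Y $ i - X $ i) \<le> g i \<bullet> (Y $ i - X $ i)"
    and total: "(\<Sum>i\<in>UNIV. Y $ i) = (\<Sum>i\<in>UNIV. X $ i)"
    and "Y \<noteq> X"
  shows "(\<Sum>i\<in>UNIV. f i (X $ i)) < (\<Sum>i\<in>UNIV. f i (Y $ i))"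
proof -
  have "c \<bullet> (\<Sum>i\<in>UNIV. Y $ i - X $ i) = 0"
    using total by (simp add: sum_subtractf)
  then have "(\<Sum>i\<in>UNIV. f i (X $ i)) = (\<Sum>i\<in>UNIV. f i (X $ i) + c \<bullet> (Y $ i - X $ i))"
    by (simp add: sum.distrib inner_sum_right)
  also have "\<dots> < (\<Sum>i\<in>UNIV. f i (Y $ i))"
  proof (rule sum_strict_mono_ex1)
    show "\<forall>i\<in>UNIV. f i (X $ i) + c \<bullet> (Y $ i - X $ i) \<le> f i (Y $ i)"
    proof
      fix i show "f i (X $ i) + c \<bullet> (Y $ i - X $ i) \<le> f i (Y $ i)"
        using above[of "Y $ i" i] vi[of i] by (cases "Y $ i = X $ i") auto
    qed
    obtain i where "Y $ i \<noteq> X $ i" using \<open>Y \<noteq> X\<close> by (auto simp: vec_eq_iff)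
    then have "f i (X $ i) + c \<bullet> (Y $ i - X $ i) < f i (Y $ i)"
      using above[of "Y $ i" i] vi[of i] by linarith
    then show "\<exists>i\<in>UNIV. f i (X $ i) + c \<bullet> (Y $ i - X $ i) < f i (Y $ i)" by blast
  qed simp
  finally show ?thesis .
qed

lemma strict_minimum_imp_unique_optimal_solution:
  assumes X: "feasible \<Omega> d X"
    and strict: "\<And>Y. feasible \<Omega> d Y \<Longrightarrow> Y \<noteq> X \<Longrightarrow>
      (\<Sum>i\<in>UNIV. f i (X $ i)) < (\<Sum>i\<in>UNIV. f i (Y $ i))"
  shows "optimal_solution \<Omega> d f X \<and> (\<forall>Y. optimal_solution \<Omega> d f Y \<longrightarrow> Y = X)"
proof (intro conjI allI impI)
  show "optimal_solution \<Omega> d f X"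
    unfolding optimal_solution_def is_arg_min_def using X strict by (metis less_asym)
  fix Y assume "optimal_solution \<Omega> d f Y"
  then show "Y = X"
    unfolding optimal_solution_def is_arg_min_def using X strict by metis
qed

lemma equilibrium_feasible:
  fixes \<Omega> :: "'n::finite \<Rightarrow> (real^'m) set"
  assumes G: "undirected_connected_graph G"
    and \<Omega>: "\<And>i. closed (\<Omega> i)" "\<And>i. \<Omega> i \<noteq> {}"
    and eq: "equilibrium G \<Omega> d f X L Z"
  shows "feasible \<Omega> d X"
  unfolding feasible_def
proof
  note swap = neighbors_symmetric[OF G]
  have "- (\<Sum>j\<in>neighbors G i. L $ i - L $ j) - (\<Sum>j\<in>neighbors G i. Z $ i - Z $ j)
      + (d $ i - X $ i) = 0" for i
    using eq by (simp add: equilibrium_def rhs_lambda_def vec_eq_iff)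
  then have "0 = (\<Sum>i\<in>UNIV. - (\<Sum>j\<in>neighbors G i. L $ i - L $ j)
      - (\<Sum>j\<in>neighbors G i. Z $ i - Z $ j) + (d $ i - X $ i))"
    by simp
  also have "\<dots> = - (\<Sum>i\<in>UNIV. \<Sum>j\<in>neighbors G i. L $ i - L $ j)
      - (\<Sum>i\<in>UNIV. \<Sum>j\<in>neighbors G i. Z $ i - Z $ j) + (\<Sum>i\<in>UNIV. d $ i - X $ i)"
    by (simp only: sum.distrib sum_subtractf sum_negf)
  also have "\<dots> = (\<Sum>i\<in>UNIV. d $ i) - (\<Sum>i\<in>UNIV. X $ i)"
    using sum_laplacian_eq_0[OF swap, of "($) L"] sum_laplacian_eq_0[OF swap, of "($) Z"]
    by (simp add: sum_subtractf)
  finally show "(\<Sum>i\<in>UNIV. X $ i) = (\<Sum>i\<in>UNIV. d $ i)" by simp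
  show "\<forall>i. X $ i \<in> \<Omega> i"
  proof
    fix i
    have "closest_point (\<Omega> i) (X $ i - gradient (f i) (X $ i) + L $ i) = X $ i"
      using eq by (simp add: equilibrium_def rhs_x_def vec_eq_iff)
    then show "X $ i \<in> \<Omega> i" using closest_point_in_set[OF \<Omega>] by metis
  qed
qed

text \<open>A point \<open>x\<close> of a closed convex set is the projection of \<open>x + w\<close> onto it exactly when \<open>w\<close> is an
  outward normal at \<open>x\<close>; here \<open>w\<close> is the multiplier minus the gradient.\<close>

lemma equilibrium_variational_inequality:
  assumes "closed (\<Omega> i)" "convex (\<Omega> i)"
    and eq: "equilibrium G \<Omega> d f X L Z" and y: "y \<in> \<Omega> i"
  shows "L $ i \<bullet> (y - X $ i) \<le> gradient (f i) (X $ i) \<bullet> (y - X $ i)"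
proof -
  let ?a = "X $ i - gradient (f i) (X $ i) + L $ i"
  have "closest_point (\<Omega> i) ?a = X $ i"
    using eq by (simp add: equilibrium_def rhs_x_def vec_eq_iff)
  then have "(?a - X $ i) \<bullet> (y - X $ i) \<le> 0"
    using closest_point_dot[OF assms(2,1) y, of ?a] by simp
  then show ?thesis by (simp add: inner_diff_left inner_add_left)
qed

theorem theorem3p1:
  fixes \<Omega> :: "'n::finite \<Rightarrow> (real^'m) set"
    and d :: "real^'m^'n"
    and f :: "'n \<Rightarrow> real^'m \<Rightarrow> real"
    and G :: "'n pair_pre_digraph"
  assumes "\<And>i. closed (\<Omega> i)" and "\<And>i. convex (\<Omega> i)"
    and assumption1: "\<And>i. admissible_objective (f i)"
    and assumption2: "\<exists>X. optimal_solution \<Omega> d f X" "slater_condition \<Omega> d"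
    and assumption3: "undirected_connected_graph G"
  shows "(\<forall>x l z. trajectory G \<Omega> d f x l z \<longrightarrow> (\<forall>i. x 0 $ i \<in> \<Omega> i) \<longrightarrow>
            (\<forall>t\<ge>0. \<forall>i. x t $ i \<in> \<Omega> i)) \<and>
         (\<forall>X L Z. equilibrium G \<Omega> d f X L Z \<longrightarrow>
            optimal_solution \<Omega> d f X \<and> (\<forall>Y. optimal_solution \<Omega> d f Y \<longrightarrow> Y = X))"
proof (rule conjI; intro allI impI)
  fix x l z t i
  assume traj: "trajectory G \<Omega> d f x l z" and x0: "\<forall>i. x 0 $ i \<in> \<Omega> i" and t: "(0::real) \<le> t"
  define p where
    "p s = closest_point (\<Omega> i) (x s $ i - gradient (f i) (x s $ i) + l s $ i)" for s
  have "((\<lambda>s. x s $ i) has_vector_derivative p s - x s $ i) (at s within {0..})" if "0 \<le> s" for s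
  proof -
    have "(x has_vector_derivative rhs_x \<Omega> f (x s) (l s)) (at s within {0..})"
      using traj that by (simp add: trajectory_def)
    from bounded_linear.has_vector_derivative[OF bounded_linear_vec_nth this, of i]
    show ?thesis by (simp add: rhs_x_def p_def)
  qed
  moreover have "p s \<in> \<Omega> i" for s
    using x0 closest_point_in_set[OF assms(1)] by (auto simp: p_def)
  ultimately show "x t $ i \<in> \<Omega> i"
    using relaxation_towards_convex_set_invariant[OF assms(1,2)] x0 t by blast
next
  fix X L Z
  assume eq: "equilibrium G \<Omega> d f X L Z"
  \<comment> \<open>Projection onto the empty set is an arbitrary value, so membership of \<open>X $ i\<close> in \<open>\<Omega> i\<close> rests on
    Slater's condition.\<close>
  have nonempty: "\<Omega> i \<noteq> {}" for i
    using assumption2(2) interior_subset by (fastforce simp: slater_condition_def)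
  have X: "feasible \<Omega> d X"
    by (rule equilibrium_feasible[OF assumption3 assms(1) nonempty eq])
  have "(\<Sum>j\<in>neighbors G i. L $ i - L $ j) = 0" for i
    using eq by (simp add: equilibrium_def rhs_z_def vec_eq_iff)
  then have "L $ i = L $ k" for i k
    by (rule laplacian_kernel_constant[OF assumption3])
  then obtain c where c: "\<And>i. L $ i = c" by blast
  have "(\<Sum>i\<in>UNIV. f i (X $ i)) < (\<Sum>i\<in>UNIV. f i (Y $ i))"
    if Y: "feasible \<Omega> d Y" "Y \<noteq> X" for Y
  proof (rule common_multiplier_imp_strict_minimum)
    show "f i (X $ i) + gradient (f i) (X $ i) \<bullet> (y - X $ i) < f i y" if "y \<noteq> X $ i" for i y
      using assumption1[of i] that
      by (intro strict_gradient_inequality) (auto simp: admissible_objective_def)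
    show "c \<bullet> (Y $ i - X $ i) \<le> gradient (f i) (X $ i) \<bullet> (Y $ i - X $ i)" for i
      using equilibrium_variational_inequality[OF assms(1,2) eq, of "Y $ i" i] Y(1) c
      by (simp add: feasible_def)
    show "(\<Sum>i\<in>UNIV. Y $ i) = (\<Sum>i\<in>UNIV. X $ i)"
      using X Y(1) by (simp add: feasible_def)
  qed fact
  then show "optimal_solution \<Omega> d f X \<and> (\<forall>Y. optimal_solution \<Omega> d f Y \<longrightarrow> Y = X)"
    by (rule strict_minimum_imp_unique_optimal_solution[OF X])
qed

end
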